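(* When $\Lambda_2>0$, the $\mathrm{SL}_2(\mathbb{R})$ transformations act transitively on the families of normalised semi-quadratic Weingarten relations with the same $\Lambda_1^2$. That is, for any two normalised semi-quadratic Weingarten relations having the same value of $\Lambda_1^2$, there is an $\mathrm{SL}_2(\mathbb{R})$ transformation mapping the first relation to the second.
   Context: A semi-quadratic Weingarten relation is an equation $\alpha k_1k_2+\beta k_1+\gamma k_2+\delta=0$ with $\alpha,\beta,\gamma,\delta\in\mathbb{R}$; it is regarded as an equation, so multiplying all coefficients by $-1$ gives the same relation. Put $\Lambda_1=\beta-\gamma$ and $\Lambda_2=(\beta+\gamma)^2-4\alpha\delta$; a relation with $\Lambda_2>0$ is normalised (after dividing by $\sqrt{\Lambda_2}$) if $\Lambda_2=1$. The transformation given by $\begin{pmatrix}a&b\\c&d\end{pmatrix}\in\mathrm{SL}_2(\mathbb{R})$ acts on relations by substituting $k_i\mapsto\frac{c+dk_i}{a+bk_i}$, $i=1,2$, and clearing denominators; the resulting coefficients are $\alpha'=\alpha d^2+\delta b^2+(\beta+\gamma)bd$, $\beta'=\alpha cd+\delta ab+(\beta+\gamma)bc+\beta$, $\gamma'=\alpha cd+\delta ab+(\beta+\gamma)bc+\gamma$, $\delta'=\alpha c^2+\delta a^2+(\beta+\gamma)ac$. *)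

theory Defs
  imports "HOL-Analysis.Analysis"
begin

datatype sqw_coeffs =
  Coeffs (al: real) (be: real) (ga: real) (de: real)

definition sqw_eval :: "sqw_coeffs \<Rightarrow> real \<Rightarrow> real \<Rightarrow> real" where
  "sqw_eval r k1 k2 = al r * k1 * k2 + be r * k1 + ga r * k2 + de r"

definition coeffs_uminus :: "sqw_coeffs \<Rightarrow> sqw_coeffs" where
  "coeffs_uminus r = Coeffs (- al r) (- be r) (- ga r) (- de r)"

definition Lambda1 :: "sqw_coeffs \<Rightarrow> real" where
  "Lambda1 r = be r - ga r"

definition coeffs_Lambda2 :: "sqw_coeffs \<Rightarrow> real" where
  "coeffs_Lambda2 r = (be r + ga r)\<^sup>2 - 4 * al r * de r"

(* The matrix with rows (a, b) and (c, d) acts by k \<mapsto> (c + d k) / (a + b k). *)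
definition sl2_subst :: "real^2^2 \<Rightarrow> real \<Rightarrow> real" where
  "sl2_subst A k = (A $ 2 $ 1 + A $ 2 $ 2 * k) / (A $ 1 $ 1 + A $ 1 $ 2 * k)"

(* The formulas for the second and third coefficient already use det A = 1;
   see coeffs_transform_subst. *)
definition coeffs_transform :: "real^2^2 \<Rightarrow> sqw_coeffs \<Rightarrow> sqw_coeffs" where
  "coeffs_transform A r =
    (let a = A $ 1 $ 1; b = A $ 1 $ 2; c = A $ 2 $ 1; d = A $ 2 $ 2; s = be r + ga r in
      Coeffs (al r * d\<^sup>2 + de r * b\<^sup>2 + s * b * d)
             (al r * c * d + de r * a * b + s * b * c + be r)
             (al r * c * d + de r * a * b + s * b * c + ga r)
             (al r * c\<^sup>2 + de r * a\<^sup>2 + s * a * c))"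

lemma coeffs_transform_subst:
  assumes "det A = 1"
    and "A $ 1 $ 1 + A $ 1 $ 2 * k1 \<noteq> 0" "A $ 1 $ 1 + A $ 1 $ 2 * k2 \<noteq> 0"
  shows "sqw_eval (coeffs_transform A r) k1 k2 =
    (A $ 1 $ 1 + A $ 1 $ 2 * k1) * (A $ 1 $ 1 + A $ 1 $ 2 * k2) *
      sqw_eval r (sl2_subst A k1) (sl2_subst A k2)"
proof -
  define a b c d where abcd: "a = A $ 1 $ 1" "b = A $ 1 $ 2" "c = A $ 2 $ 1" "d = A $ 2 $ 2"
  have det: "a * d = 1 + b * c"
    using assms(1) by (simp add: det_2 abcd)
  have nz: "a + b * k1 \<noteq> 0" "a + b * k2 \<noteq> 0"
    using assms(2,3) by (simp_all add: abcd)
  have "(a + b * k1) * (a + b * k2) * sqw_eval r (sl2_subst A k1) (sl2_subst A k2) =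
      al r * (c + d * k1) * (c + d * k2) + be r * (c + d * k1) * (a + b * k2)
      + ga r * (c + d * k2) * (a + b * k1) + de r * (a + b * k1) * (a + b * k2)"
  proof -
    have "p * q * (x * (u / p) * (v / q) + y * (u / p) + z * (v / q) + w) =
        x * u * v + y * u * q + z * v * p + w * p * q"
      if "p \<noteq> 0" "q \<noteq> 0" for p q u v w x y z :: real
      using that by (simp add: field_simps)
    from this[OF nz] show ?thesis
      by (simp add: sqw_eval_def sl2_subst_def abcd[symmetric])
  qed
  also have "\<dots> = sqw_eval (coeffs_transform A r) k1 k2"
    unfolding sqw_eval_def coeffs_transform_def Let_def abcd[symmetric] sqw_coeffs.sel
    using det by algebra
  finally show ?thesis
    by (simp add: abcd)
qed

definition same_equation :: "sqw_coeffs \<Rightarrow> sqw_coeffs \<Rightarrow> bool" where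
  "same_equation r s \<longleftrightarrow> r = s \<or> r = coeffs_uminus s"

(* A relation is an equation, so coefficient tuples are identified up to a common sign.
   Identifying further multiples would leave Lambda_2, hence normalisation, undefined. *)
quotient_type sqw_relation = sqw_coeffs / same_equation
  by (rule equivpI)
     (auto simp: reflp_def symp_def transp_def same_equation_def coeffs_uminus_def)

lift_definition Lambda1_sq :: "sqw_relation \<Rightarrow> real" is "\<lambda>r. (Lambda1 r)\<^sup>2"
  by (auto simp: same_equation_def coeffs_uminus_def Lambda1_def power2_commute)

lift_definition Lambda2 :: "sqw_relation \<Rightarrow> real" is coeffs_Lambda2
  by (auto simp: same_equation_def coeffs_uminus_def coeffs_Lambda2_def power2_eq_square
      algebra_simps)

lift_definition transform :: "real^2^2 \<Rightarrow> sqw_relation \<Rightarrow> sqw_relation" is coeffs_transform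
  by (auto simp: same_equation_def coeffs_uminus_def coeffs_transform_def Let_def algebra_simps)

definition normalised :: "sqw_relation \<Rightarrow> bool" where
  "normalised R \<longleftrightarrow> Lambda2 R = 1"

lemma Lambda1_sq_transform: "Lambda1_sq (transform A R) = Lambda1_sq R"
  by transfer (simp add: Lambda1_def coeffs_transform_def Let_def)

lemma Lambda2_transform:
  assumes "det A = 1"
  shows "Lambda2 (transform A R) = Lambda2 R"
  using assms
proof transfer
  fix A :: "real^2^2" and r
  assume "det A = 1"
  then have "A $ 1 $ 1 * A $ 2 $ 2 - A $ 1 $ 2 * A $ 2 $ 1 = 1"
    by (simp add: det_2)
  then show "coeffs_Lambda2 (coeffs_transform A r) = coeffs_Lambda2 r"
    unfolding coeffs_Lambda2_def coeffs_transform_def Let_def sqw_coeffs.sel by algebra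
qed

end

(* A relation is determined by Lambda_1 and the binary quadratic form with coefficients
   (alpha, beta + gamma, delta), whose discriminant is Lambda_2; the transformations fix
   Lambda_1 and act on the form by the usual change of variables. A form of discriminant 1
   splits into real linear factors and is therefore SL_2-equivalent to xy, so every normalised
   relation lies in the orbit of the one with form xy and the same Lambda_1. Relations whose
   Lambda_1 differ in sign are matched by negating the coefficients of one of them. *)

theory Submission
  imports Defs
begin

lemma coeffs_transform_mat_1: "coeffs_transform (mat 1) r = r"
  by (cases r) (simp add: coeffs_transform_def mat_def)

text \<open>A matrix acts on \<open>k\<close> as on the ratio \<open>y / x\<close> of a vector
  \<open>(x, y)\<close>, so substitutions compose like matrices. Substituting into relations
  reverses the order, which makes this a right action.\<close>

lemma coeffs_transform_compose:
  assumes "det A = 1" "det B = 1"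
  shows "coeffs_transform B (coeffs_transform A r) = coeffs_transform (A ** B) r"
proof -
  obtain a b c d where A: "A $ 1 $ 1 = a" "A $ 1 $ 2 = b" "A $ 2 $ 1 = c" "A $ 2 $ 2 = d"
    by blast
  obtain a' b' c' d' where B: "B $ 1 $ 1 = a'" "B $ 1 $ 2 = b'" "B $ 2 $ 1 = c'" "B $ 2 $ 2 = d'"
    by blast
  have det: "a * d - b * c = 1" "a' * d' - b' * c' = 1"
    using assms by (simp_all add: det_2 A B)
  have AB: "(A ** B) $ 1 $ 1 = a * a' + b * c'" "(A ** B) $ 1 $ 2 = a * b' + b * d'"
    "(A ** B) $ 2 $ 1 = c * a' + d * c'" "(A ** B) $ 2 $ 2 = c * b' + d * d'"
    by (simp_all add: matrix_matrix_mult_def sum_2 A B)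
  show ?thesis
    unfolding coeffs_transform_def Let_def sqw_coeffs.sel sqw_coeffs.inject A B AB
    using det by (intro conjI; algebra)
qed

lemma coeffs_transform_inverse:
  assumes "det A = 1"
  obtains B where "det B = 1" "\<And>r. coeffs_transform B (coeffs_transform A r) = r"
proof -
  have "invertible A"
    using assms by (simp add: invertible_det_nz)
  then obtain B where AB: "A ** B = mat 1"
    unfolding invertible_def by blast
  then have "det B = 1"
    using assms det_mul[of A B] by simp
  with assms AB that show thesis
    by (simp add: coeffs_transform_compose coeffs_transform_mat_1)
qed

definition split_form :: "real \<Rightarrow> sqw_coeffs" where
  "split_form l = Coeffs 0 ((1 + l) / 2) ((1 - l) / 2) 0"

(* The form of r factors as (d x + c y) (b x + a y) with a d - b c = 1, so that
   a d = (s + 1) / 2 and b c = (s - 1) / 2 for s = beta + gamma. *)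
lemma transform_split_form:
  assumes "coeffs_Lambda2 r = 1"
  obtains A where "det A = 1" "coeffs_transform A (split_form (Lambda1 r)) = r"
proof -
  define s where "s = be r + ga r"
  have disc: "4 * al r * de r = (s + 1) * (s - 1)"
    using assms by (simp add: coeffs_Lambda2_def s_def power2_eq_square algebra_simps)
  have "\<exists>a b c d. b * d = al r \<and> a * c = de r \<and> 2 * (b * c) = s - 1 \<and> 2 * (a * d) = s + 1"
  proof (cases "s = -1")
    case False
    then have "2 * (2 * al r / (s + 1) * de r) = s - 1" "2 * al r / (s + 1) * ((s + 1) / 2) = al r"
      using disc by (simp_all add: field_simps)
    \<comment> \<open>Here \<open>a * d\<close> is nonzero, so rescaling the two linear factors
      reciprocally allows \<open>a = 1\<close>; this forces \<open>d\<close>, \<open>c\<close> and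
      \<open>b\<close>.\<close>
    then show ?thesis
      by (intro exI[of _ 1] exI[of _ "2 * al r / (s + 1)"] exI[of _ "de r"]
          exI[of _ "(s + 1) / 2"]) simp
  next
    case True
    with disc have "al r = 0 \<or> de r = 0"
      by simp
    \<comment> \<open>Now \<open>b * c = -1\<close>, met by \<open>b = 1\<close> and
      \<open>c = -1\<close>. The outer coefficients then force \<open>a\<close> and
      \<open>d\<close>, and \<open>a * d = 0\<close> because one of those coefficients
      vanishes.\<close>
    with True show ?thesis
      by (intro exI[of _ "- de r"] exI[of _ 1] exI[of _ "-1"] exI[of _ "al r"]) auto
  qed
  then obtain a b c d where abcd: "b * d = al r" "a * c = de r"
    "2 * (b * c) = s - 1" "2 * (a * d) = s + 1"
    by blast
  define A :: "real^2^2" where "A = vector [vector [a, b], vector [c, d]]"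
  have "det A = 1"
    using abcd by (simp add: det_2 A_def)
  moreover have "coeffs_transform A (split_form (Lambda1 r)) = r"
    using abcd
    by (cases r) (simp add: coeffs_transform_def split_form_def Lambda1_def A_def s_def
        add_divide_distrib diff_divide_distrib ac_simps)
  ultimately show thesis
    by (rule that)
qed

text \<open>Both tuples lie in the orbit of the same \<open>split_form\<close>: go back from
  \<open>r\<close> to it, then on to \<open>s\<close>.\<close>

lemma coeffs_transform_transitive:
  assumes "coeffs_Lambda2 r = 1" "coeffs_Lambda2 s = 1" "Lambda1 r = Lambda1 s"
  shows "\<exists>A. det A = 1 \<and> coeffs_transform A r = s"
proof -
  obtain A where A: "det A = 1" "coeffs_transform A (split_form (Lambda1 r)) = r"
    using transform_split_form assms(1) by blast
  obtain B where B: "det B = 1" "coeffs_transform B (split_form (Lambda1 r)) = s"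
    using transform_split_form assms(2,3) by metis
  obtain A' where A': "det A' = 1" "\<And>t. coeffs_transform A' (coeffs_transform A t) = t"
    using coeffs_transform_inverse A(1) by blast
  have "coeffs_transform (A' ** B) r = s"
    using A A' B coeffs_transform_compose by metis
  moreover have "det (A' ** B) = 1"
    using A' B by (simp add: det_mul)
  ultimately show ?thesis
    by blast
qed

theorem proposition4p23:
  fixes R S :: sqw_relation
  assumes "normalised R" and "normalised S"
    and "Lambda1_sq R = Lambda1_sq S"
  shows "\<exists>A :: real^2^2. det A = 1 \<and> transform A R = S"
  using assms unfolding normalised_def
proof transfer
  fix r s
  assume r: "coeffs_Lambda2 r = 1" and s: "coeffs_Lambda2 s = 1"
    and "(Lambda1 r)\<^sup>2 = (Lambda1 s)\<^sup>2"
  then consider "Lambda1 r = Lambda1 s" | "Lambda1 r = Lambda1 (coeffs_uminus s)"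
    by (auto simp: power2_eq_iff Lambda1_def coeffs_uminus_def)
  then show "\<exists>A. det A = 1 \<and> same_equation (coeffs_transform A r) s"
  proof cases
    case 1
    then show ?thesis
      using coeffs_transform_transitive r s unfolding same_equation_def by blast
  next
    case 2
    \<comment> \<open>The target becomes \<open>coeffs_uminus s\<close>, another representative of
      the relation of \<open>s\<close>.\<close>
    have "coeffs_Lambda2 (coeffs_uminus s) = 1"
      using s by (simp add: coeffs_Lambda2_def coeffs_uminus_def power2_eq_square algebra_simps)
    then show ?thesis
      using coeffs_transform_transitive r 2 unfolding same_equation_def by blast
  qed
qed

end
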